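(* Consider the Pauli channel with channel matrix $A=\mathrm{Diag}(\lambda_1,\lambda_2,0)$ (third direction and $\lambda_3=0$ known, angle parameter $\phi=0$), where $\lambda_1,\lambda_2$ are real with $|\lambda_1\pm\lambda_2|\le1$. Assume that $\lambda_1>\lambda_2$ and $\lambda_1\ne-\lambda_2$, and let $N\ge1$ be an integer. For a measurement angle $\tau\in\mathbb{R}$ and an input angle $\vartheta\in\mathbb{R}$ let $\tilde h_2(\lambda_1,\lambda_2,0,\tau,\vartheta,N)=\mathbf{E}(\tilde\phi-\phi)^2=\mathbf{E}(\tilde\phi^2)$ be the mean squared error of the linearized angle estimator $\tilde\phi$ defined in the context. 1. If $(\lambda_1+\lambda_2)^2\ge2(\lambda_1-\lambda_2)^2$, then $\tilde h_2(\lambda_1,\lambda_2,0,\tau,\vartheta,N)$, as a function of $(\tau,\vartheta)$, is minimal if and only if $$\tau=\vartheta=\frac\pi4\quad\left(\mathrm{mod}\ \frac\pi2\right)$$ (i.e. $\tau$ and $\vartheta$ are each congruent to $\frac\pi4$ modulo $\frac\pi2$), and the minimal value is $$\tilde h_2\left(\lambda_1,\lambda_2,0,\tfrac\pi4,\tfrac\pi4,N\right)=\frac{1}{4(\lambda_1-\lambda_2)^2}\,\frac1{2N}\left(4-(\lambda_1+\lambda_2)^2\right).$$ 2. If $(\lambda_1+\lambda_2)^2<2(\lambda_1-\lambda_2)^2$, put $x=\frac14\arccos\left(-\frac{(\lambda_1+\lambda_2)^2}{2(\lambda_1-\lambda_2)^2}\right)$. Then $\tilde h_2(\lambda_1,\lambda_2,0,\tau,\vartheta,N)$,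 as a function of $(\tau,\vartheta)$, is minimal if and only if $$\tau=\vartheta=x\ \text{ or }\ \tau=\vartheta=\frac\pi2-x\quad\left(\mathrm{mod}\ \frac\pi2\right)$$ (i.e. either $\tau$ and $\vartheta$ are both congruent to $x$ modulo $\frac\pi2$, or both are congruent to $\frac\pi2-x$ modulo $\frac\pi2$), and the minimal value is $$\frac{1}{4(\lambda_1-\lambda_2)^2}\,\frac1{2N}\left(4-(\lambda_1^2+\lambda_2^2)-\frac18\,\frac{(\lambda_1+\lambda_2)^4}{(\lambda_1-\lambda_2)^2}\right).$$
   Context: Let $R(\phi)=\begin{pmatrix}\cos\phi&-\sin\phi&0\\ \sin\phi&\cos\phi&0\\0&0&1\end{pmatrix}$. The channel matrices considered are $A(\lambda_1,\lambda_2,\phi)=R(\phi)\,\mathrm{Diag}(\lambda_1,\lambda_2,0)\,R(\phi)^{-1}$; here $\phi=0$. The input matrix is $\Theta=R(\vartheta)$ and the measurement matrix is $M=R(\tau)$ (columns are the Bloch vectors of the input states, respectively of the measurements). Put $X=(x_{ij})_{i,j=1}^3=M^TA\Theta$. The measured data are independent random variables $N_{ij}\sim\mathrm{Binom}\left(N,\frac{1+x_{ij}}2\right)$. Estimators: $\hat x_{ij}=\frac2N N_{ij}-1$, $\hat X=(\hat x_{ij})$, $\hat A=M\hat X\Theta^T$. Angle estimator: for a real matrix $B$ near $A$, let $B_s$ be the symmetrization $\frac12(B'+B'^T)$ of the upper-left $2\times2$ block $B'$ of $B$, and let $\hat\phi(B)\in(-\frac\pi2,\frac\pi2]$ be the angle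 such that $(\cos\hat\phi(B),\sin\hat\phi(B))^T$ is an eigenvector of $B_s$ for its larger eigenvalue (so $\hat\phi(A(\lambda_1,\lambda_2,\phi))=\phi$ for $\phi$ near $0$). The linearized estimator is the first-order Taylor polynomial at $A$: $\tilde\phi=\hat\phi(A)+\langle\mathrm{grad}\,\hat\phi(A),\hat A-A\rangle$, with $\langle\cdot,\cdot\rangle$ the Hilbert--Schmidt inner product on real matrices. *)

theory Defs
  imports "HOL-Probability.Probability" "HOL-Library.Real_Mod"
begin

definition rot :: "real \<Rightarrow> real^3^3" where
  "rot \<phi> = vector [vector [cos \<phi>, - sin \<phi>, 0],
                    vector [sin \<phi>,   cos \<phi>, 0],
                    vector [0,       0,       1]]"

definition Diag :: "real^'n \<Rightarrow> real^'n^'n" where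
  "Diag v = (\<chi> i j. if i = j then v $ i else 0)"

definition channel :: "real \<Rightarrow> real \<Rightarrow> real \<Rightarrow> real^3^3" where
  "channel l1 l2 \<phi> = rot \<phi> ** Diag (vector [l1, l2, 0]) ** matrix_inv (rot \<phi>)"

text \<open>Measurement matrix \<open>M\<close> and input matrix \<open>\<Theta>\<close> (Bloch vectors as columns) give
  \<open>X = M\<^sup>T A \<Theta>\<close>.\<close>

definition outcome_matrix :: "real^3^3 \<Rightarrow> real^3^3 \<Rightarrow> real^3^3 \<Rightarrow> real^3^3" where
  "outcome_matrix M A \<Theta> = transpose M ** A ** \<Theta>"

text \<open>Joint law of the counts \<open>N\<^sub>i\<^sub>j\<close>: the product over all nine index pairs of
  \<open>Binom(N, (1 + x\<^sub>i\<^sub>j)/2)\<close>. The default value \<open>0\<close> of \<open>Pi_pmf\<close> plays no role,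
  as the index set is \<open>UNIV\<close>.\<close>

definition data_pmf :: "nat \<Rightarrow> real^3^3 \<Rightarrow> (3 \<times> 3 \<Rightarrow> nat) pmf" where
  "data_pmf N X = Pi_pmf UNIV 0 (\<lambda>(i, j). binomial_pmf N ((1 + X $ i $ j) / 2))"

definition X_hat :: "nat \<Rightarrow> (3 \<times> 3 \<Rightarrow> nat) \<Rightarrow> real^3^3" where
  "X_hat N n = (\<chi> i j. 2 / real N * real (n (i, j)) - 1)"

definition A_hat :: "real^3^3 \<Rightarrow> real^3^3 \<Rightarrow> nat \<Rightarrow> (3 \<times> 3 \<Rightarrow> nat) \<Rightarrow> real^3^3" where
  "A_hat M \<Theta> N n = M ** X_hat N n ** transpose \<Theta>"

definition upper_left :: "real^3^3 \<Rightarrow> real^2^2" where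
  "upper_left B = vector [vector [B $ 1 $ 1, B $ 1 $ 2], vector [B $ 2 $ 1, B $ 2 $ 2]]"

definition sym_part :: "real^3^3 \<Rightarrow> real^2^2" where
  "sym_part B = (1 / 2) *\<^sub>R (upper_left B + transpose (upper_left B))"

definition eigenpair :: "real^'n^'n \<Rightarrow> real^'n \<Rightarrow> real \<Rightarrow> bool" where
  "eigenpair B v c \<longleftrightarrow> v \<noteq> 0 \<and> B *v v = c *\<^sub>R v"

text \<open>The angle is unique when the two eigenvalues of \<open>sym_part B\<close> differ, hence for all
  \<open>B\<close> near \<open>channel l1 l2 \<phi>\<close> with \<open>l1 > l2\<close>. If they coincide, the value is
  unspecified.\<close>

definition phi_hat :: "real^3^3 \<Rightarrow> real" where
  "phi_hat B = (THE \<phi>. \<phi> \<in> {- pi / 2 <.. pi / 2} \<and>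
     (\<exists>c. eigenpair (sym_part B) (vector [cos \<phi>, sin \<phi>]) c \<and>
          (\<forall>v c'. eigenpair (sym_part B) v c' \<longrightarrow> c' \<le> c)))"

definition grad :: "('a::real_inner \<Rightarrow> real) \<Rightarrow> 'a \<Rightarrow> 'a" where
  "grad f x = (THE D. GDERIV f x :> D)"

text \<open>The inner product of the type \<open>real^3^3\<close> is the sum of the products of corresponding
  entries, i.e. the Hilbert--Schmidt inner product.\<close>

definition phi_tilde :: "real^3^3 \<Rightarrow> real^3^3 \<Rightarrow> real" where
  "phi_tilde A B = phi_hat A + grad phi_hat A \<bullet> (B - A)"

definition h2_tilde :: "real \<Rightarrow> real \<Rightarrow> real \<Rightarrow> real \<Rightarrow> real \<Rightarrow> nat \<Rightarrow> real" where
  "h2_tilde l1 l2 \<phi> \<tau> \<theta> N =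
     (let A = channel l1 l2 \<phi>; M = rot \<tau>; \<Theta> = rot \<theta>
      in measure_pmf.expectation (data_pmf N (outcome_matrix M A \<Theta>))
           (\<lambda>n. (phi_tilde A (A_hat M \<Theta> N n) - \<phi>)\<^sup>2))"

definition is_minimizer2 :: "('a \<Rightarrow> 'b \<Rightarrow> real) \<Rightarrow> 'a \<Rightarrow> 'b \<Rightarrow> bool" where
  "is_minimizer2 f a b \<longleftrightarrow> (\<forall>a' b'. f a b \<le> f a' b')"

end

theory Submission
  imports Defs
begin

text \<open>
  Near \<open>A = Diag(l1, l2, 0)\<close> the angle estimator is
  \<open>arctan ((B 1 2 + B 2 1) / (B 1 1 - B 2 2)) / 2\<close>, so its linearization only sees the
  off-diagonal sum of \<open>B\<close>, a linear combination of the nine independent counts whose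
  variance is a weighted sum of the \<open>1 - x\<^sub>i\<^sub>j\<^sup>2\<close>. Decomposing the upper-left block of \<open>A\<close> as
  \<open>p\<close> times the identity plus \<open>q\<close> times the reflection \<open>Diag(1, -1)\<close> makes the error depend on
  the angles only through \<open>w = sin\<^sup>2(\<tau> + \<theta>)\<close> and \<open>u = cos\<^sup>2(\<theta> - \<tau>)\<close>, and minimizing it means
  maximizing \<open>p\<^sup>2 (w u + (1 - w) (1 - u)) + 2 q\<^sup>2 w (1 - w)\<close>. This is affine in \<open>u\<close> and invariant
  under \<open>(w, u) \<mapsto> (1 - w, 1 - u)\<close>, so one may take \<open>w \<ge> 1/2\<close> and \<open>u = 1\<close>; what remains is a concave
  parabola in \<open>w\<close> whose vertex lies beyond \<open>w = 1\<close> exactly when \<open>p\<^sup>2 \<ge> 2 q\<^sup>2\<close>.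
\<close>

subsection \<open>Moments of independent binomial counts\<close>

text \<open>Independence factors each mixed product in the expanded square into two zero means, so
  only the diagonal terms survive; finite supports settle integrability.\<close>

lemma expectation_square_sum_Pi_pmf:
  fixes f :: "'a \<Rightarrow> 'b \<Rightarrow> real"
  assumes I: "finite I" and fin: "\<And>i. i \<in> I \<Longrightarrow> finite (set_pmf (p i))"
    and mean: "\<And>i. i \<in> I \<Longrightarrow> measure_pmf.expectation (p i) (f i) = 0"
  shows "measure_pmf.expectation (Pi_pmf I d p) (\<lambda>n. (\<Sum>i\<in>I. f i (n i))\<^sup>2) =
         (\<Sum>i\<in>I. measure_pmf.expectation (p i) (\<lambda>v. (f i v)\<^sup>2))"
proof -
  let ?P = "Pi_pmf I d p"
  have "finite (PiE_dflt I d (\<lambda>i. set_pmf (p i)))"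
    using I fin by (intro finite_PiE_dflt) auto
  then have finP: "finite (set_pmf ?P)"
    using set_Pi_pmf[OF I, of d p] by (simp add: o_def)
  have int: "integrable (measure_pmf ?P) g" for g :: "('a \<Rightarrow> 'b) \<Rightarrow> real"
    by (rule integrable_measure_pmf_finite[OF finP])
  have comp: "measure_pmf.expectation ?P (\<lambda>n. g (n i)) = measure_pmf.expectation (p i) g"
    if "i \<in> I" for i and g :: "'b \<Rightarrow> real"
  proof -
    have "measure_pmf.expectation (map_pmf (\<lambda>n. n i) ?P) g = measure_pmf.expectation (p i) g"
      using Pi_pmf_component[OF I, of i d p] that by simp
    then show ?thesis by simp
  qed
  have cross: "measure_pmf.expectation ?P (\<lambda>n. f i (n i) * f j (n j)) =
      (if i = j then measure_pmf.expectation (p i) (\<lambda>v. (f i v)\<^sup>2) else 0)"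
    if ij: "i \<in> I" "j \<in> I" for i j
  proof (cases "i = j")
    case True
    with comp[OF ij(1), of "\<lambda>v. f i v * f i v"] show ?thesis by (simp add: power2_eq_square)
  next
    case False
    have "prob_space.indep_vars (measure_pmf ?P) (\<lambda>_. borel) (\<lambda>x n. f x (n x)) I"
      by (rule prob_space.indep_vars_compose2[OF measure_pmf.prob_space_axioms indep_vars_Pi_pmf[OF I]]) simp
    then have "prob_space.indep_vars (measure_pmf ?P) (\<lambda>_. borel) (\<lambda>x n. f x (n x)) {i, j}"
      by (rule prob_space.indep_vars_subset[OF measure_pmf.prob_space_axioms]) (use ij in auto)
    then have "measure_pmf.expectation ?P (\<lambda>n. \<Prod>x\<in>{i, j}. f x (n x)) =
        (\<Prod>x\<in>{i, j}. measure_pmf.expectation ?P (\<lambda>n. f x (n x)))"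
      by (intro prob_space.indep_vars_lebesgue_integral[OF measure_pmf.prob_space_axioms] int) auto
    with False show ?thesis by (simp add: comp[OF ij(1)] mean[OF ij(1)])
  qed
  have "measure_pmf.expectation ?P (\<lambda>n. (\<Sum>i\<in>I. f i (n i))\<^sup>2) =
        (\<Sum>i\<in>I. \<Sum>j\<in>I. measure_pmf.expectation ?P (\<lambda>n. f i (n i) * f j (n j)))"
    by (simp add: power2_eq_square sum_product Bochner_Integration.integral_sum int)
  also have "\<dots> = (\<Sum>i\<in>I. measure_pmf.expectation (p i) (\<lambda>v. (f i v)\<^sup>2))"
    by (simp add: cross sum.delta' I cong: sum.cong)
  finally show ?thesis .
qed

lemma binomial_pmf_expectation:
  assumes "p \<in> {0..1}"
  shows "measure_pmf.expectation (binomial_pmf n p) real = real n * p"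
  using assms sum_k_Bernstein[of n p]
  by (simp add: expectation_binomial_pmf' Bernstein_def mult_ac)

text \<open>Splitting \<open>k^2 = k * (k - 1) + k\<close> reduces the second moment to the
  factorial moments given by the Bernstein identities.\<close>

lemma binomial_pmf_variance:
  assumes "p \<in> {0..1}"
  shows "measure_pmf.variance (binomial_pmf n p) real = real n * p * (1 - p)"
proof -
  have "(\<Sum>k\<le>n. (real k)\<^sup>2 * Bernstein n k p) =
      (\<Sum>k\<le>n. real k * (real k - 1) * Bernstein n k p) + (\<Sum>k\<le>n. real k * Bernstein n k p)"
    unfolding sum.distrib[symmetric]
    by (intro sum.cong) (simp_all add: power2_eq_square algebra_simps)
  also have "\<dots> = real n * (real n - 1) * p\<^sup>2 + real n * p"
    by (simp only: sum_kk_Bernstein sum_k_Bernstein)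
  finally have "measure_pmf.expectation (binomial_pmf n p) (\<lambda>k. (real k)\<^sup>2) =
      real n * (real n - 1) * p\<^sup>2 + real n * p"
    using assms by (simp add: expectation_binomial_pmf' Bernstein_def mult_ac)
  moreover have "measure_pmf.variance (binomial_pmf n p) real =
      measure_pmf.expectation (binomial_pmf n p) (\<lambda>k. (real k)\<^sup>2)
      - (measure_pmf.expectation (binomial_pmf n p) real)\<^sup>2"
    using assms by (intro measure_pmf.variance_eq) auto
  ultimately show ?thesis
    using assms by (simp add: binomial_pmf_expectation power2_eq_square algebra_simps)
qed

subsection \<open>The angle estimator and its gradient\<close>

lemma sym_part_components:
  "sym_part B $ 1 $ 1 = B $ 1 $ 1" "sym_part B $ 1 $ 2 = (B $ 1 $ 2 + B $ 2 $ 1) / 2"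
  "sym_part B $ 2 $ 1 = (B $ 1 $ 2 + B $ 2 $ 1) / 2" "sym_part B $ 2 $ 2 = B $ 2 $ 2"
  by (simp_all add: sym_part_def upper_left_def transpose_def)

lemma eigenpair_sym_part_iff:
  "eigenpair (sym_part B) v c \<longleftrightarrow> v \<noteq> 0 \<and>
     B $ 1 $ 1 * v $ 1 + (B $ 1 $ 2 + B $ 2 $ 1) / 2 * v $ 2 = c * v $ 1 \<and>
     (B $ 1 $ 2 + B $ 2 $ 1) / 2 * v $ 1 + B $ 2 $ 2 * v $ 2 = c * v $ 2"
  by (simp add: eigenpair_def vec_eq_iff matrix_vector_mult_def sum_2 forall_2 sym_part_components)

text \<open>The symmetrized block is \<open>m\<close> times the identity plus \<open>r > 0\<close>
  times the reflection in the line at angle \<psi>, so its top eigenvector points along \<psi>. The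
  hypothesis puts \<psi> strictly between \<open>- pi / 4\<close> and \<open>pi / 4\<close>, where
  \<open>arctan\<close> needs no branch correction.\<close>

lemma phi_hat_eq:
  assumes "B $ 1 $ 1 > B $ 2 $ 2"
  shows "phi_hat B = arctan ((B $ 1 $ 2 + B $ 2 $ 1) / (B $ 1 $ 1 - B $ 2 $ 2)) / 2"
proof -
  define a where "a = B $ 1 $ 1"
  define b where "b = (B $ 1 $ 2 + B $ 2 $ 1) / 2"
  define d where "d = B $ 2 $ 2"
  define \<psi> where "\<psi> = arctan (2 * b / (a - d)) / 2"
  define m where "m = (a + d) / 2"
  define r where "r = (a - d) / (2 * cos (2 * \<psi>))"
  have ad: "a > d" using assms by (simp add: a_def d_def)
  have \<psi>: "- pi / 4 < \<psi>" "\<psi> < pi / 4"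
    using arctan_lbound[of "2 * b / (a - d)"] arctan_ubound[of "2 * b / (a - d)"]
    by (auto simp: \<psi>_def)
  have cpos: "cos (2 * \<psi>) > 0" using \<psi> by (intro cos_gt_zero_pi) auto
  have "tan (2 * \<psi>) = 2 * b / (a - d)" by (simp add: \<psi>_def tan_arctan)
  then have b: "b = r * sin (2 * \<psi>)"
    using cpos ad by (simp add: r_def tan_def field_simps)
  have a: "a = m + r * cos (2 * \<psi>)" and d: "d = m - r * cos (2 * \<psi>)"
    using cpos by (simp_all add: r_def m_def field_simps)
  have r: "r > 0" using cpos ad by (simp add: r_def)
  note eig = eigenpair_sym_part_iff[of B, folded a_def b_def d_def]
  have bound: "c \<le> m + r" if "eigenpair (sym_part B) v c" for v c
  proof -
    define x y where "x = v $ 1" and "y = v $ 2"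
    from that have v: "x \<noteq> 0 \<or> y \<noteq> 0"
      and e: "(a - c) * x + b * y = 0" "b * x + (d - c) * y = 0"
      unfolding eig by (auto simp: vec_eq_iff forall_2 x_def y_def algebra_simps)
    \<comment> \<open>Applying the adjugate of the shifted matrix shows that its determinant
      annihilates both coordinates; one of them is nonzero, so the determinant vanishes.\<close>
    have "((a - c) * (d - c) - b\<^sup>2) * x = (d - c) * ((a - c) * x + b * y) - b * (b * x + (d - c) * y)"
      "((a - c) * (d - c) - b\<^sup>2) * y = (a - c) * (b * x + (d - c) * y) - b * ((a - c) * x + b * y)"
      by (simp_all add: algebra_simps power2_eq_square)
    with v have "(a - c) * (d - c) = b\<^sup>2" unfolding e by auto
    then have "(c - m)\<^sup>2 = (r * sin (2 * \<psi>))\<^sup>2 + (r * cos (2 * \<psi>))\<^sup>2"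
      unfolding a b d by (simp add: algebra_simps power2_eq_square)
    also have "\<dots> = r\<^sup>2"
      by (simp add: power_mult_distrib flip: distrib_left)
    finally have "\<bar>c - m\<bar> = \<bar>r\<bar>" by (simp add: power2_eq_iff abs_eq_iff)
    with r show ?thesis by linarith
  qed
  \<comment> \<open>The reflection carries the direction \<phi> to
    \<open>2 * \<psi> - \<phi>\<close>, hence fixes the direction \<psi>.\<close>
  have rotate: "a * cos \<phi> + b * sin \<phi> = m * cos \<phi> + r * cos (2 * \<psi> - \<phi>)"
    "b * cos \<phi> + d * sin \<phi> = m * sin \<phi> + r * sin (2 * \<psi> - \<phi>)" for \<phi>
    unfolding a b d by (simp_all add: cos_diff sin_diff algebra_simps)
  have nz: "vector [cos \<phi>, sin \<phi>] \<noteq> (0 :: real^2)" for \<phi>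
    using sin_zero_abs_cos_one[of \<phi>] by (auto simp: vec_eq_iff forall_2)
  have top: "eigenpair (sym_part B) (vector [cos \<psi>, sin \<psi>]) (m + r)"
    unfolding eig using nz rotate[of \<psi>] by (simp add: algebra_simps)
  have "phi_hat B = \<psi>"
    unfolding phi_hat_def
  proof (rule the_equality)
    show "\<psi> \<in> {- pi / 2<..pi / 2} \<and> (\<exists>c. eigenpair (sym_part B) (vector [cos \<psi>, sin \<psi>]) c \<and>
        (\<forall>v c'. eigenpair (sym_part B) v c' \<longrightarrow> c' \<le> c))"
      using top bound \<psi> by auto
  next
    fix \<phi> assume *: "\<phi> \<in> {- pi / 2<..pi / 2} \<and> (\<exists>c. eigenpair (sym_part B) (vector [cos \<phi>, sin \<phi>]) c \<and>
        (\<forall>v c'. eigenpair (sym_part B) v c' \<longrightarrow> c' \<le> c))"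
    then obtain c where c: "eigenpair (sym_part B) (vector [cos \<phi>, sin \<phi>]) c" "m + r \<le> c"
      using top by blast
    with bound have "c = m + r" by fastforce
    with c have "m * cos \<phi> + r * cos (2 * \<psi> - \<phi>) = (m + r) * cos \<phi>"
      "m * sin \<phi> + r * sin (2 * \<psi> - \<phi>) = (m + r) * sin \<phi>"
      unfolding eig rotate[symmetric] by auto
    with r have "cos (2 * \<psi> - \<phi>) = cos \<phi>" "sin (2 * \<psi> - \<phi>) = sin \<phi>"
      by (auto simp: algebra_simps)
    \<comment> \<open>The directions \<open>2 * \<psi> - \<phi>\<close> and \<phi> coincide, so
      \<open>\<psi> - \<phi>\<close> is a multiple of \<open>pi\<close>; the ranges of both angles
      leave only 0.\<close>
    then have "cos (2 * \<psi> - \<phi> - \<phi>) = 1"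
      unfolding cos_diff[of "2 * \<psi> - \<phi>" \<phi>] by (simp flip: power2_eq_square)
    moreover have "2 * \<psi> - \<phi> - \<phi> = 2 * (\<psi> - \<phi>)" by simp
    ultimately have "cos (2 * (\<psi> - \<phi>)) = 1" by metis
    then have "sin (\<psi> - \<phi>) = 0" unfolding cos_double_sin by simp
    moreover have "- pi < \<psi> - \<phi>" "\<psi> - \<phi> < pi" using * \<psi> by auto
    ultimately show "\<phi> = \<psi>" using sin_eq_0_pi[of "\<psi> - \<phi>"] by simp
  qed
  moreover have "2 * b = B $ 1 $ 2 + B $ 2 $ 1" by (simp add: b_def)
  ultimately show ?thesis by (simp only: \<psi>_def a_def d_def)
qed

text \<open>Supplies the uniqueness behind the definite description in \<open>grad\<close>: two
  candidates have equal inner products with every vector, in particular with their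
  difference.\<close>

lemma grad_eqI:
  assumes "GDERIV f x :> D"
  shows "grad f x = D"
  unfolding grad_def
proof (rule the_equality)
  show "GDERIV f x :> D" by fact
next
  fix D' assume "GDERIV f x :> D'"
  with assms have "(\<lambda>h. h \<bullet> D') = (\<lambda>h. h \<bullet> D)"
    unfolding gderiv_def by (rule has_derivative_unique[rotated])
  then have "(D' - D) \<bullet> D' = (D' - D) \<bullet> D" by metis
  then have "(D' - D) \<bullet> (D' - D) = 0" by (simp add: inner_diff_right)
  then show "D' = D" by simp
qed

text \<open>The \<open>arctan\<close> formula holds on an open neighbourhood of \<open>A\<close> and
  can be differentiated there. Its numerator vanishes at \<open>A\<close>, so the denominator
  contributes no derivative and \<open>arctan\<close> has slope 1.\<close>

lemma has_derivative_phi_hat: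
  assumes gap: "A $ 1 $ 1 > A $ 2 $ 2" and sym: "A $ 1 $ 2 + A $ 2 $ 1 = 0"
  shows "(phi_hat has_derivative
    (\<lambda>H. (H $ 1 $ 2 + H $ 2 $ 1) / (2 * (A $ 1 $ 1 - A $ 2 $ 2)))) (at A)"
proof (rule has_derivative_transform_within_open)
  let ?S = "{B :: real^3^3. B $ 2 $ 2 < B $ 1 $ 1}"
  show "open ?S"
    by (intro open_Collect_less continuous_intros)
  show "A \<in> ?S" using gap by simp
  show "arctan ((B $ 1 $ 2 + B $ 2 $ 1) / (B $ 1 $ 1 - B $ 2 $ 2)) / 2 = phi_hat B"
    if "B \<in> ?S" for B
    using that phi_hat_eq[of B] by simp
  have nth: "((\<lambda>B :: real^3^3. B $ i $ j) has_derivative (\<lambda>H. H $ i $ j)) (at A)" for i j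
    by (intro bounded_linear_imp_has_derivative bounded_linear_compose[OF bounded_linear_vec_nth]
        bounded_linear_vec_nth)
  let ?num = "\<lambda>B :: real^3^3. B $ 1 $ 2 + B $ 2 $ 1" and ?den = "\<lambda>B :: real^3^3. B $ 1 $ 1 - B $ 2 $ 2"
  have "((\<lambda>B. ?num B / ?den B) has_derivative
      (\<lambda>H. - ?num A * (inverse (?den A) * ?den H * inverse (?den A)) + ?num H / ?den A)) (at A)"
    by (intro has_derivative_divide has_derivative_add has_derivative_diff nth) (use gap in simp)
  then have "((\<lambda>B. ?num B / ?den B) has_derivative (\<lambda>H. ?num H / ?den A)) (at A)"
    unfolding sym by simp
  from DERIV_compose_FDERIV[OF DERIV_arctan this]
  have "((\<lambda>B. arctan (?num B / ?den B)) has_derivative (\<lambda>H. ?num H / ?den A)) (at A)"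
    unfolding sym by simp
  from bounded_linear.has_derivative[OF bounded_linear_divide[of 2] this]
  show "((\<lambda>B. arctan (?num B / ?den B) / 2) has_derivative
      (\<lambda>H. ?num H / (2 * ?den A))) (at A)"
    by (simp add: mult.commute)
qed

lemma grad_phi_hat:
  assumes gap: "A $ 1 $ 1 > A $ 2 $ 2" and sym: "A $ 1 $ 2 + A $ 2 $ 1 = 0"
  shows "grad phi_hat A = vector [vector [0, 1 / (2 * (A $ 1 $ 1 - A $ 2 $ 2)), 0],
    vector [1 / (2 * (A $ 1 $ 1 - A $ 2 $ 2)), 0, 0], 0]"
proof (rule grad_eqI)
  show "GDERIV phi_hat A :> vector [vector [0, 1 / (2 * (A $ 1 $ 1 - A $ 2 $ 2)), 0],
    vector [1 / (2 * (A $ 1 $ 1 - A $ 2 $ 2)), 0, 0], 0]"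
    unfolding gderiv_def
    by (rule has_derivative_eq_rhs[OF has_derivative_phi_hat[OF assms]])
       (simp add: fun_eq_iff inner_vec_def sum_3 add_divide_distrib)
qed

lemma phi_tilde_eq:
  assumes gap: "A $ 1 $ 1 > A $ 2 $ 2" and sym: "A $ 1 $ 2 + A $ 2 $ 1 = 0"
  shows "phi_tilde A B = (B $ 1 $ 2 + B $ 2 $ 1) / (2 * (A $ 1 $ 1 - A $ 2 $ 2))"
proof -
  have "phi_hat A = 0"
    using phi_hat_eq[OF gap] sym by simp
  moreover have "grad phi_hat A \<bullet> (B - A) =
      ((B $ 1 $ 2 + B $ 2 $ 1) - (A $ 1 $ 2 + A $ 2 $ 1)) / (2 * (A $ 1 $ 1 - A $ 2 $ 2))"
    unfolding grad_phi_hat[OF assms]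
    by (simp add: inner_vec_def sum_3 add_divide_distrib diff_divide_distrib)
  ultimately show ?thesis
    using sym by (simp add: phi_tilde_def)
qed

subsection \<open>The mean squared error in closed form\<close>

lemma channel_0: "channel l1 l2 0 = Diag (vector [l1, l2, 0])"
proof -
  have rot0: "rot 0 = mat 1"
    by (simp add: rot_def mat_def vec_eq_iff forall_3)
  have "matrix_inv (mat 1 :: real^3^3) = mat 1"
    by (simp add: matrix_inv_def)
  then show ?thesis by (simp add: channel_def rot0)
qed

text \<open>Exposes the quantity seen by the linearized estimator as a linear form in the nine
  independent data, with deterministic weights.\<close>

lemma A_hat_offdiagonal_sum:
  "A_hat M \<Theta> N n $ 1 $ 2 + A_hat M \<Theta> N n $ 2 $ 1 =
   (\<Sum>(i, j)\<in>UNIV. (M $ 1 $ i * \<Theta> $ 2 $ j + M $ 2 $ i * \<Theta> $ 1 $ j) * X_hat N n $ i $ j)"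
  unfolding UNIV_Times_UNIV[symmetric] sum.cartesian_product[symmetric]
  by (simp add: A_hat_def matrix_matrix_mult_def transpose_def sum_3 algebra_simps)

text \<open>Between the two rotations the identity part \<open>p\<close> of the block becomes a
  rotation by \<open>\<theta> - \<tau>\<close>, while the reflection part \<open>q\<close> stays a
  reflection, with angle governed by \<open>\<tau> + \<theta>\<close>.\<close>

lemma outcome_matrix_rot:
  fixes l1 l2 \<tau> \<theta> :: real
  defines "X \<equiv> outcome_matrix (rot \<tau>) (channel l1 l2 0) (rot \<theta>)"
    and "p \<equiv> (l1 + l2) / 2" and "q \<equiv> (l1 - l2) / 2"
  shows "X $ 1 $ 1 = p * cos (\<theta> - \<tau>) + q * cos (\<tau> + \<theta>)"
    and "X $ 1 $ 2 = - p * sin (\<theta> - \<tau>) - q * sin (\<tau> + \<theta>)"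
    and "X $ 2 $ 1 = p * sin (\<theta> - \<tau>) - q * sin (\<tau> + \<theta>)"
    and "X $ 2 $ 2 = p * cos (\<theta> - \<tau>) - q * cos (\<tau> + \<theta>)"
    and "X $ 3 $ j = 0" and "X $ i $ 3 = 0"
  by (simp_all add: X_def channel_0 outcome_matrix_def matrix_matrix_mult_def transpose_def sum_3
      Diag_def rot_def p_def q_def cos_diff sin_diff cos_add sin_add field_simps)

text \<open>Ensures that \<open>(1 + x) / 2\<close> is a genuine probability for every entry
  \<open>x\<close>, as the binomial moment formulas require.\<close>

lemma outcome_matrix_bounds:
  assumes "\<bar>l1 + l2\<bar> \<le> 1" "\<bar>l1 - l2\<bar> \<le> 1"
  shows "\<bar>outcome_matrix (rot \<tau>) (channel l1 l2 0) (rot \<theta>) $ i $ j\<bar> \<le> 1"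
proof -
  have *: "\<bar>(l1 + l2) / 2 * s + (l1 - l2) / 2 * t\<bar> \<le> 1" if "\<bar>s\<bar> \<le> 1" "\<bar>t\<bar> \<le> 1" for s t :: real
  proof -
    have "\<bar>(l1 + l2) / 2 * s\<bar> \<le> 1 / 2 * 1" "\<bar>(l1 - l2) / 2 * t\<bar> \<le> 1 / 2 * 1"
      unfolding abs_mult using that assms by (auto intro!: mult_le_one)
    then show ?thesis by linarith
  qed
  have "\<forall>i j. \<bar>outcome_matrix (rot \<tau>) (channel l1 l2 0) (rot \<theta>) $ i $ j\<bar> \<le> 1"
    unfolding forall_3 outcome_matrix_rot
    using *[of "cos (\<theta> - \<tau>)" "cos (\<tau> + \<theta>)"] *[of "cos (\<theta> - \<tau>)" "- cos (\<tau> + \<theta>)"]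
      *[of "- sin (\<theta> - \<tau>)" "- sin (\<tau> + \<theta>)"] *[of "sin (\<theta> - \<tau>)" "- sin (\<tau> + \<theta>)"]
    by simp
  then show ?thesis by blast
qed

text \<open>The linearized estimator is unbiased, so its mean squared error is a variance, and the
  variances of the nine independent terms add up.\<close>

lemma h2_tilde_eq_sum:
  fixes l1 l2 \<tau> \<theta> :: real and N :: nat
  defines "X \<equiv> outcome_matrix (rot \<tau>) (channel l1 l2 0) (rot \<theta>)"
    and "W \<equiv> (\<lambda>i j. rot \<tau> $ 1 $ i * rot \<theta> $ 2 $ j + rot \<tau> $ 2 $ i * rot \<theta> $ 1 $ j)"
  assumes "\<bar>l1 + l2\<bar> \<le> 1" "\<bar>l1 - l2\<bar> \<le> 1" "l1 > l2" "N \<ge> 1"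
  shows "h2_tilde l1 l2 0 \<tau> \<theta> N =
     1 / (4 * (l1 - l2)\<^sup>2) * (1 / real N) * (\<Sum>i\<in>UNIV. \<Sum>j\<in>UNIV. (W i j)\<^sup>2 * (1 - (X $ i $ j)\<^sup>2))"
proof -
  let ?A = "channel l1 l2 0"
  define P where "P = (\<lambda>(i, j). (1 + X $ i $ j) / 2)"
  \<comment> \<open>The centred contribution of one count: the factor \<open>2 / N\<close> from
    \<open>X_hat\<close> cancels the 2 in the gradient entry
    \<open>1 / (2 * (l1 - l2))\<close>.\<close>
  define f where "f = (\<lambda>(i, j) v. W i j / ((l1 - l2) * real N) * (real v - real N * P (i, j)))"
  have N: "real N > 0" using assms by simp
  have P: "P ij \<in> {0..1}" for ij
    using outcome_matrix_bounds[OF assms(3,4), of \<tau> \<theta> "fst ij" "snd ij"]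
    by (auto simp: P_def X_def split: prod.splits)
  have A: "?A $ 1 $ 1 = l1" "?A $ 2 $ 2 = l2" "?A $ 1 $ 2 = 0" "?A $ 2 $ 1 = 0"
    by (simp_all add: channel_0 Diag_def)
  \<comment> \<open>This is the off-diagonal sum of \<open>A\<close> expressed through
    \<open>X\<close>; since it is zero, subtracting it centres every term without changing the
    estimate.\<close>
  have WX: "(\<Sum>i\<in>UNIV. \<Sum>j\<in>UNIV. W i j * X $ i $ j) = 0"
  proof -
    have "(\<Sum>i\<in>UNIV. \<Sum>j\<in>UNIV. W i j * X $ i $ j) =
      sin (\<tau> + \<theta>) * (X $ 1 $ 1 - X $ 2 $ 2) + cos (\<tau> + \<theta>) * (X $ 1 $ 2 + X $ 2 $ 1)"
      by (simp add: W_def sum_3 rot_def sin_add cos_add algebra_simps)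
    also have "\<dots> = 0"
      unfolding X_def outcome_matrix_rot by (simp add: algebra_simps)
    finally show ?thesis .
  qed
  have tilde: "phi_tilde ?A (A_hat (rot \<tau>) (rot \<theta>) N n) = (\<Sum>ij\<in>UNIV. f ij (n ij))" for n
  proof -
    have "phi_tilde ?A (A_hat (rot \<tau>) (rot \<theta>) N n) =
        (\<Sum>i\<in>UNIV. \<Sum>j\<in>UNIV. W i j * X_hat N n $ i $ j) / (2 * (l1 - l2))"
      using assms by (simp add: phi_tilde_eq A A_hat_offdiagonal_sum W_def sum.cartesian_product)
    also have "\<dots> = (\<Sum>i\<in>UNIV. \<Sum>j\<in>UNIV. W i j * (X_hat N n $ i $ j - X $ i $ j)) / (2 * (l1 - l2))"
      using WX by (simp add: right_diff_distrib sum_subtractf)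
    also have "\<dots> = (\<Sum>i\<in>UNIV. \<Sum>j\<in>UNIV. f (i, j) (n (i, j)))"
      unfolding sum_divide_distrib
      by (intro sum.cong refl) (use N assms(5) in \<open>simp add: f_def P_def X_hat_def field_simps\<close>)
    finally show ?thesis by (simp add: sum.cartesian_product)
  qed
  have mean: "measure_pmf.expectation (binomial_pmf N (P ij)) (f ij) = 0" for ij
    using integrable_binomial_pmf[OF P, of N ij real] binomial_pmf_expectation[OF P, of N ij]
    by (cases ij) (simp add: f_def)
  have var: "measure_pmf.expectation (binomial_pmf N (P (i, j))) (\<lambda>v. (f (i, j) v)\<^sup>2) =
      1 / (4 * (l1 - l2)\<^sup>2) * (1 / real N) * ((W i j)\<^sup>2 * (1 - (X $ i $ j)\<^sup>2))" for i j
  proof -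
    have "measure_pmf.expectation (binomial_pmf N (P (i, j))) (\<lambda>v. (f (i, j) v)\<^sup>2) =
        (W i j / ((l1 - l2) * real N))\<^sup>2 * (real N * P (i, j) * (1 - P (i, j)))"
      using binomial_pmf_variance[OF P, of N "(i, j)"]
      unfolding binomial_pmf_expectation[OF P] f_def prod.case power_mult_distrib by simp
    also have "\<dots> = 1 / (l1 - l2)\<^sup>2 * (1 / real N) * ((W i j)\<^sup>2 * (P (i, j) * (1 - P (i, j))))"
      using N by (simp add: power_divide power_mult_distrib power2_eq_square)
    also have "P (i, j) * (1 - P (i, j)) = (1 - (X $ i $ j)\<^sup>2) / 4"
      by (simp add: P_def power2_eq_square field_simps)
    also have "1 / (l1 - l2)\<^sup>2 * (1 / real N) * ((W i j)\<^sup>2 * ((1 - (X $ i $ j)\<^sup>2) / 4)) =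
        1 / (4 * (l1 - l2)\<^sup>2) * (1 / real N) * ((W i j)\<^sup>2 * (1 - (X $ i $ j)\<^sup>2))"
      by simp
    finally show ?thesis .
  qed
  have "h2_tilde l1 l2 0 \<tau> \<theta> N =
      measure_pmf.expectation (Pi_pmf UNIV 0 (\<lambda>ij. binomial_pmf N (P ij))) (\<lambda>n. (\<Sum>ij\<in>UNIV. f ij (n ij))\<^sup>2)"
    by (simp add: h2_tilde_def Let_def data_pmf_def tilde P_def case_prod_unfold flip: X_def)
  also have "\<dots> = (\<Sum>ij\<in>UNIV. measure_pmf.expectation (binomial_pmf N (P ij)) (\<lambda>v. (f ij v)\<^sup>2))"
    using P mean by (intro expectation_square_sum_Pi_pmf) auto
  also have "\<dots> = (\<Sum>i\<in>UNIV. \<Sum>j\<in>UNIV.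
      1 / (4 * (l1 - l2)\<^sup>2) * (1 / real N) * ((W i j)\<^sup>2 * (1 - (X $ i $ j)\<^sup>2)))"
    unfolding var[symmetric] by (simp add: sum.cartesian_product)
  finally show ?thesis by (simp add: sum_distrib_left)
qed

text \<open>The squared weights are \<open>w\<close> on the diagonal of the block,
  \<open>1 - w\<close> off it and zero elsewhere. Hence only the sums of squares of the two diagonal
  and of the two off-diagonal entries of \<open>X\<close> matter.\<close>

lemma h2_tilde_closed_form:
  fixes l1 l2 \<tau> \<theta> :: real and N :: nat
  defines "p \<equiv> (l1 + l2) / 2" and "q \<equiv> (l1 - l2) / 2"
    and "w \<equiv> (sin (\<tau> + \<theta>))\<^sup>2" and "u \<equiv> (cos (\<theta> - \<tau>))\<^sup>2"
  assumes "\<bar>l1 + l2\<bar> \<le> 1" "\<bar>l1 - l2\<bar> \<le> 1" "l1 > l2" "N \<ge> 1"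
  shows "h2_tilde l1 l2 0 \<tau> \<theta> N = 1 / (4 * (l1 - l2)\<^sup>2) * (1 / (2 * real N)) *
     (4 - 4 * (p\<^sup>2 * (w * u + (1 - w) * (1 - u)) + 2 * q\<^sup>2 * (w * (1 - w))))"
proof -
  define X where "X = outcome_matrix (rot \<tau>) (channel l1 l2 0) (rot \<theta>)"
  define W where "W = (\<lambda>i j. rot \<tau> $ 1 $ i * rot \<theta> $ 2 $ j + rot \<tau> $ 2 $ i * rot \<theta> $ 1 $ j)"
  have W: "W 1 1 = sin (\<tau> + \<theta>)" "W 1 2 = cos (\<tau> + \<theta>)" "W 2 1 = cos (\<tau> + \<theta>)"
    "W 2 2 = - sin (\<tau> + \<theta>)" "W i 3 = 0" "W 3 j = 0" for i j
    by (simp_all add: W_def rot_def sin_add cos_add)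
  have w': "(cos (\<tau> + \<theta>))\<^sup>2 = 1 - w" and u': "(sin (\<theta> - \<tau>))\<^sup>2 = 1 - u"
    unfolding w_def u_def using sin_cos_squared_add[of "\<tau> + \<theta>"] sin_cos_squared_add[of "\<theta> - \<tau>"]
    by linarith+
  \<comment> \<open>The parallelogram identity removes the mixed terms in
    \<open>p * q\<close>.\<close>
  have sq: "(a + b)\<^sup>2 + (a - b)\<^sup>2 = 2 * a\<^sup>2 + 2 * b\<^sup>2" for a b :: real
    by (simp add: power2_eq_square algebra_simps)
  have diag: "(X $ 1 $ 1)\<^sup>2 + (X $ 2 $ 2)\<^sup>2 = 2 * p\<^sup>2 * u + 2 * q\<^sup>2 * (1 - w)"
    using sq[of "p * cos (\<theta> - \<tau>)" "q * cos (\<tau> + \<theta>)"]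
    unfolding X_def outcome_matrix_rot p_def[symmetric] q_def[symmetric]
    by (simp add: power_mult_distrib w' flip: u_def)
  have off: "(X $ 1 $ 2)\<^sup>2 + (X $ 2 $ 1)\<^sup>2 = 2 * p\<^sup>2 * (1 - u) + 2 * q\<^sup>2 * w"
  proof -
    have "X $ 1 $ 2 = - (q * sin (\<tau> + \<theta>) + p * sin (\<theta> - \<tau>))"
      "X $ 2 $ 1 = - (q * sin (\<tau> + \<theta>) - p * sin (\<theta> - \<tau>))"
      unfolding X_def outcome_matrix_rot p_def q_def by simp_all
    then show ?thesis
      using sq[of "q * sin (\<tau> + \<theta>)" "p * sin (\<theta> - \<tau>)"]
      by (simp only: power2_minus) (simp add: power_mult_distrib u' flip: w_def)
  qed
  have "(\<Sum>i\<in>UNIV. \<Sum>j\<in>UNIV. (W i j)\<^sup>2 * (1 - (X $ i $ j)\<^sup>2)) =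
      w * (2 - ((X $ 1 $ 1)\<^sup>2 + (X $ 2 $ 2)\<^sup>2)) + (1 - w) * (2 - ((X $ 1 $ 2)\<^sup>2 + (X $ 2 $ 1)\<^sup>2))"
    by (simp add: sum_3 W w' algebra_simps flip: w_def)
  also have "\<dots> = (4 - 4 * (p\<^sup>2 * (w * u + (1 - w) * (1 - u)) + 2 * q\<^sup>2 * (w * (1 - w)))) / 2"
    unfolding diag off by (simp add: field_simps)
  finally have total: "(\<Sum>i\<in>UNIV. \<Sum>j\<in>UNIV. (W i j)\<^sup>2 * (1 - (X $ i $ j)\<^sup>2)) =
      (4 - 4 * (p\<^sup>2 * (w * u + (1 - w) * (1 - u)) + 2 * q\<^sup>2 * (w * (1 - w)))) / 2" .
  have h: "h2_tilde l1 l2 0 \<tau> \<theta> N = 1 / (4 * (l1 - l2)\<^sup>2) * (1 / real N) *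
      (\<Sum>i\<in>UNIV. \<Sum>j\<in>UNIV. (W i j)\<^sup>2 * (1 - (X $ i $ j)\<^sup>2))"
    using h2_tilde_eq_sum[OF assms(5-8), of \<tau> \<theta>] unfolding X_def W_def .
  show ?thesis unfolding h total by simp
qed

subsection \<open>Minimization\<close>

text \<open>\<open>w0\<close> is the vertex of the parabola \<open>F w 1\<close>, cut off at 1. The
  assumption \<open>p \<noteq> 0\<close> places it strictly above \<open>1 / 2\<close>, which is
  what determines \<open>u\<close> at the maximum.\<close>

lemma tradeoff_maximum:
  fixes p q u w w0 :: real
  assumes "p \<noteq> 0" "q \<noteq> 0" "0 \<le> u" "u \<le> 1" "0 \<le> w" "w \<le> 1"
    and w0: "w0 = (if p\<^sup>2 \<ge> 2 * q\<^sup>2 then 1 else 1 / 2 + p\<^sup>2 / (4 * q\<^sup>2))"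
  defines "F \<equiv> (\<lambda>w u. p\<^sup>2 * (w * u + (1 - w) * (1 - u)) + 2 * q\<^sup>2 * (w * (1 - w)))"
  shows "F w u \<le> F w0 1"
    and "F w u = F w0 1 \<longleftrightarrow> w = w0 \<and> u = 1 \<or> w = 1 - w0 \<and> u = 0"
proof -
  have p: "p\<^sup>2 > 0" and q: "q\<^sup>2 > 0" using assms by auto
  have w0_half: "w0 > 1 / 2" using p q w0 by auto
  have vertex: "F w 1 \<le> F w0 1 \<and> (F w 1 = F w0 1 \<longrightarrow> w = w0)" if w: "w \<le> 1" for w
  proof (cases "p\<^sup>2 \<ge> 2 * q\<^sup>2")
    case True
    with w0 have diff: "F w0 1 - F w 1 = (1 - w) * (p\<^sup>2 - 2 * q\<^sup>2 * w)"
      by (simp add: F_def algebra_simps)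
    show ?thesis
    proof (cases "w = 1")
      case False
      \<comment> \<open>Strictness for \<open>w < 1\<close> makes the maximizer unique even in the
        boundary case \<open>p^2 = 2 * q^2\<close>.\<close>
      with w q have "2 * q\<^sup>2 * w < 2 * q\<^sup>2" by simp
      with True False w have "0 < (1 - w) * (p\<^sup>2 - 2 * q\<^sup>2 * w)" by (intro mult_pos_pos) auto
      with diff show ?thesis by linarith
    qed (use True w0 in simp)
  next
    case False
    \<comment> \<open>Eliminating \<open>p^2\<close> in favour of the vertex completes the
      square.\<close>
    with w0 q have p2: "p\<^sup>2 = 2 * q\<^sup>2 * (2 * w0 - 1)" by (simp add: field_simps)
    have diff: "F w0 1 - F w 1 = 2 * q\<^sup>2 * (w - w0)\<^sup>2"
      unfolding F_def p2 by (simp add: power2_eq_square algebra_simps)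
    have "2 * q\<^sup>2 * (w - w0)\<^sup>2 \<ge> 0" by simp
    moreover have "2 * q\<^sup>2 * (w - w0)\<^sup>2 = 0 \<longleftrightarrow> w = w0" using q by simp
    ultimately show ?thesis using diff by linarith
  qed
  have upper: "F w u \<le> F w0 1 \<and> (F w u = F w0 1 \<longrightarrow> w = w0 \<and> u = 1)"
    if "1 / 2 \<le> w" "w \<le> 1" "u \<le> 1" for w u
  proof -
    have diff: "F w 1 - F w u = p\<^sup>2 * ((2 * w - 1) * (1 - u))"
      by (simp add: F_def algebra_simps)
    have "p\<^sup>2 * ((2 * w - 1) * (1 - u)) \<ge> 0" using that by simp
    \<comment> \<open>At \<open>w = 1 / 2\<close> the value is independent of \<open>u\<close>, so
      equality must first force \<open>w = w0 > 1 / 2\<close> through \<open>vertex\<close>.\<close>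
    moreover have "u = 1" if "p\<^sup>2 * ((2 * w - 1) * (1 - u)) = 0" "w = w0"
      using that p w0_half by auto
    moreover note vertex[OF that(2)]
    ultimately show ?thesis using diff by auto
  qed
  have swap: "F w u = F (1 - w) (1 - u)" for w u by (simp add: F_def algebra_simps)
  have "F w u \<le> F w0 1 \<and> (F w u = F w0 1 \<longrightarrow> w = w0 \<and> u = 1 \<or> w = 1 - w0 \<and> u = 0)"
  proof (cases "1 / 2 \<le> w")
    case True
    with upper[of w u] assms show ?thesis by blast
  next
    case False
    with upper[of "1 - w" "1 - u"] assms show ?thesis unfolding swap[of w u] by auto
  qed
  then show "F w u \<le> F w0 1"
    and "F w u = F w0 1 \<longleftrightarrow> w = w0 \<and> u = 1 \<or> w = 1 - w0 \<and> u = 0"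
    using swap[of w0 1] by auto
qed

section \<open>Trigonometric equations and congruences modulo \<open>pi / 2\<close>\<close>

lemma cos_add_int_pi: "cos (y + of_int k * pi) = (if even k then cos y else - cos y)"
  by (simp add: cos_add mult.commute[of _ pi])

lemma cos_eq_intE:
  fixes x y :: real
  assumes "cos x = cos y"
  obtains n :: int where "x = y + 2 * n * pi \<or> x = - y + 2 * n * pi"
  using assms unfolding cos_eq by (auto elim!: Ints_cases)

text \<open>Doubling the angles turns the conditions into
  \<open>cos (2 * (\<tau> + \<theta>)) = \<plusminus> cos (4 * x)\<close> and
  \<open>cos (2 * (\<theta> - \<tau>)) = \<plusminus> 1\<close> with a common sign. The two classes
  arise because \<open>cos (4 * x)\<close> is invariant under
  \<open>x \<mapsto> pi / 2 - x\<close>.\<close>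

lemma rcong_half_pi_pair_iff:
  fixes \<tau> \<theta> x :: real
  defines "w \<equiv> (sin (\<tau> + \<theta>))\<^sup>2" and "u \<equiv> (cos (\<theta> - \<tau>))\<^sup>2" and "w0 \<equiv> (sin (2 * x))\<^sup>2"
  shows "w = w0 \<and> u = 1 \<or> w = 1 - w0 \<and> u = 0 \<longleftrightarrow>
     [\<tau> = x] (rmod (pi / 2)) \<and> [\<theta> = x] (rmod (pi / 2)) \<or>
     [\<tau> = pi / 2 - x] (rmod (pi / 2)) \<and> [\<theta> = pi / 2 - x] (rmod (pi / 2))"
    (is "?L \<longleftrightarrow> ?R")
proof -
  have w: "w = (1 - cos (2 * (\<tau> + \<theta>))) / 2" and u: "u = (1 + cos (2 * (\<theta> - \<tau>))) / 2"
    and w0: "w0 = (1 - cos (4 * x)) / 2"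
    using cos_double_sin[of "2 * x"] cos_double_sin[of "\<tau> + \<theta>"] cos_double_cos[of "\<theta> - \<tau>"]
    by (simp_all add: w_def u_def w0_def)
  have L: "?L \<longleftrightarrow> cos (2 * (\<tau> + \<theta>)) = cos (4 * x) \<and> cos (2 * (\<theta> - \<tau>)) = 1 \<or>
      cos (2 * (\<tau> + \<theta>)) = - cos (4 * x) \<and> cos (2 * (\<theta> - \<tau>)) = - 1"
    unfolding w u w0 by argo
  have sol: "?L" if "[\<tau> = y] (rmod (pi / 2))" "[\<theta> = y] (rmod (pi / 2))" "cos (4 * y) = cos (4 * x)" for y
  proof -
    from that obtain m n where "y = \<tau> + of_int m * (pi / 2)" "y = \<theta> + of_int n * (pi / 2)"
      unfolding rcong_altdef by blast
    then have "2 * (\<tau> + \<theta>) = 4 * y + of_int (- m - n) * pi" "2 * (\<theta> - \<tau>) = 0 + of_int (m - n) * pi"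
      by (simp_all add: algebra_simps)
    then have "cos (2 * (\<tau> + \<theta>)) = (if even (- m - n) then cos (4 * x) else - cos (4 * x))"
      "cos (2 * (\<theta> - \<tau>)) = (if even (m - n) then 1 else - 1)"
      by (simp_all only: cos_add_int_pi that cos_zero)
    \<comment> \<open>\<open>- m - n\<close> and \<open>m - n\<close> have the same parity, so the
      two signs agree.\<close>
    then show ?thesis unfolding L by simp
  qed
  show ?thesis
  proof
    assume ?R
    moreover have "cos (4 * (pi / 2 - x)) = cos (4 * x)"
      by (simp add: right_diff_distrib cos_diff)
    ultimately show ?L using sol by blast
  next
    assume ?L
    \<comment> \<open>The common sign becomes a common shift by \<open>k * pi\<close>, where 0 and 1
      suffice for \<open>k\<close>.\<close>
    then obtain k :: int where "cos (2 * (\<tau> + \<theta>)) = cos (4 * x + of_int k * pi)"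
        "cos (2 * (\<theta> - \<tau>)) = cos (0 + of_int k * pi)"
      unfolding L cos_add_int_pi by (metis cos_zero even_zero odd_one)
    then obtain k m n :: int where
      s: "2 * (\<tau> + \<theta>) = (4 * x + k * pi) + 2 * n * pi \<or> 2 * (\<tau> + \<theta>) = - (4 * x + k * pi) + 2 * n * pi"
      and d: "2 * (\<theta> - \<tau>) = k * pi + 2 * m * pi \<or> 2 * (\<theta> - \<tau>) = - (k * pi) + 2 * m * pi"
      using cos_eq_intE[of "2 * (\<tau> + \<theta>)" "4 * x + of_int k * pi"]
        cos_eq_intE[of "2 * (\<theta> - \<tau>)" "0 + of_int k * pi"] by (metis add_0)
    \<comment> \<open>Adding and subtracting \<open>s\<close> and \<open>d\<close> isolates
      \<open>4 * \<theta>\<close> and \<open>4 * \<tau>\<close>. The shared \<open>k\<close> makes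
      all multiples of \<open>pi\<close> even, so the shifts are integer multiples of
      \<open>pi / 2\<close>. The sign of \<open>4 * x\<close> selects the class; the 1 in the last
      witnesses is the \<open>pi / 2\<close> of \<open>pi / 2 - x\<close>.\<close>
    have "\<exists>(a :: int) (b :: int). (x = \<tau> + a * (pi / 2) \<and> x = \<theta> + b * (pi / 2)) \<or>
        (pi / 2 - x = \<tau> + a * (pi / 2) \<and> pi / 2 - x = \<theta> + b * (pi / 2))"
      using s
    proof
      assume s: "2 * (\<tau> + \<theta>) = (4 * x + k * pi) + 2 * n * pi"
      from d show ?thesis
      proof
        assume "2 * (\<theta> - \<tau>) = k * pi + 2 * m * pi"
        with s show ?thesis
          by - (rule exI[of _ "m - n"], rule exI[of _ "- k - m - n"], rule disjI1, rule conjI;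
            simp add: algebra_simps add_divide_distrib diff_divide_distrib)
      next
        assume "2 * (\<theta> - \<tau>) = - (k * pi) + 2 * m * pi"
        with s show ?thesis
          by - (rule exI[of _ "m - n - k"], rule exI[of _ "- m - n"], rule disjI1, rule conjI;
            simp add: algebra_simps add_divide_distrib diff_divide_distrib)
      qed
    next
      assume s: "2 * (\<tau> + \<theta>) = - (4 * x + k * pi) + 2 * n * pi"
      from d show ?thesis
      proof
        assume "2 * (\<theta> - \<tau>) = k * pi + 2 * m * pi"
        with s show ?thesis
          by - (rule exI[of _ "1 + k + m - n"], rule exI[of _ "1 - m - n"], rule disjI2, rule conjI;
            simp add: algebra_simps add_divide_distrib diff_divide_distrib)
      next
        assume "2 * (\<theta> - \<tau>) = - (k * pi) + 2 * m * pi"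
        with s show ?thesis
          by - (rule exI[of _ "1 + m - n"], rule exI[of _ "1 + k - m - n"], rule disjI2, rule conjI;
            simp add: algebra_simps add_divide_distrib diff_divide_distrib)
      qed
    qed
    then show ?R unfolding rcong_altdef by blast
  qed
qed

theorem theorem14:
  fixes l1 l2 :: real and N :: nat and h :: "real \<Rightarrow> real \<Rightarrow> real" and x :: real
  assumes "\<bar>l1 + l2\<bar> \<le> 1" and "\<bar>l1 - l2\<bar> \<le> 1"
    and "l1 > l2" and "l1 \<noteq> - l2" and "N \<ge> 1"
  defines "h \<equiv> (\<lambda>\<tau> \<theta>. h2_tilde l1 l2 0 \<tau> \<theta> N)"
    and "x \<equiv> 1 / 4 * arccos (- ((l1 + l2)\<^sup>2 / (2 * (l1 - l2)\<^sup>2)))"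
  shows "((l1 + l2)\<^sup>2 \<ge> 2 * (l1 - l2)\<^sup>2 \<longrightarrow>
      (\<forall>\<tau> \<theta>. is_minimizer2 h \<tau> \<theta> \<longleftrightarrow>
         [\<tau> = pi / 4] (rmod (pi / 2)) \<and> [\<theta> = pi / 4] (rmod (pi / 2))) \<and>
      h (pi / 4) (pi / 4) =
        1 / (4 * (l1 - l2)\<^sup>2) * (1 / (2 * real N)) * (4 - (l1 + l2)\<^sup>2)) \<and>
    ((l1 + l2)\<^sup>2 < 2 * (l1 - l2)\<^sup>2 \<longrightarrow>
      (\<forall>\<tau> \<theta>. is_minimizer2 h \<tau> \<theta> \<longleftrightarrow>
         [\<tau> = x] (rmod (pi / 2)) \<and> [\<theta> = x] (rmod (pi / 2)) \<or>
         [\<tau> = pi / 2 - x] (rmod (pi / 2)) \<and> [\<theta> = pi / 2 - x] (rmod (pi / 2))) \<and>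
      (\<forall>\<tau> \<theta>. is_minimizer2 h \<tau> \<theta> \<longrightarrow> h \<tau> \<theta> =
         1 / (4 * (l1 - l2)\<^sup>2) * (1 / (2 * real N)) *
         (4 - (l1\<^sup>2 + l2\<^sup>2) - 1 / 8 * ((l1 + l2) ^ 4 / (l1 - l2)\<^sup>2))))"
proof -
  define p q where "p = (l1 + l2) / 2" and "q = (l1 - l2) / 2"
  define F where "F = (\<lambda>w u. p\<^sup>2 * (w * u + (1 - w) * (1 - u)) + 2 * q\<^sup>2 * (w * (1 - w)))"
  define w0 where "w0 = (if p\<^sup>2 \<ge> 2 * q\<^sup>2 then 1 else 1 / 2 + p\<^sup>2 / (4 * q\<^sup>2))"
  define K where "K = 1 / (4 * (l1 - l2)\<^sup>2) * (1 / (2 * real N))"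
  let ?w = "\<lambda>\<tau> \<theta> :: real. (sin (\<tau> + \<theta>))\<^sup>2" and ?u = "\<lambda>\<tau> \<theta> :: real. (cos (\<theta> - \<tau>))\<^sup>2"
  have nz: "p \<noteq> 0" "q \<noteq> 0" using assms by (auto simp: p_def q_def)
  have K: "K > 0" using assms by (simp add: K_def)
  have h: "h \<tau> \<theta> = K * (4 - 4 * F (?w \<tau> \<theta>) (?u \<tau> \<theta>))" for \<tau> \<theta>
    unfolding h_def K_def F_def p_def q_def
    using assms(1-3,5) by (rule h2_tilde_closed_form)
  have unit: "0 \<le> ?w \<tau> \<theta>" "?w \<tau> \<theta> \<le> 1" "0 \<le> ?u \<tau> \<theta>" "?u \<tau> \<theta> \<le> 1" for \<tau> \<theta>
    by (simp_all add: abs_square_le_1)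
  have F_le: "F (?w \<tau> \<theta>) (?u \<tau> \<theta>) \<le> F w0 1"
    and F_eq: "F (?w \<tau> \<theta>) (?u \<tau> \<theta>) = F w0 1 \<longleftrightarrow>
      ?w \<tau> \<theta> = w0 \<and> ?u \<tau> \<theta> = 1 \<or> ?w \<tau> \<theta> = 1 - w0 \<and> ?u \<tau> \<theta> = 0" for \<tau> \<theta>
    unfolding F_def by (rule tradeoff_maximum[OF nz unit(3,4,1,2) w0_def])+
  have regime: "p\<^sup>2 \<ge> 2 * q\<^sup>2 \<longleftrightarrow> (l1 + l2)\<^sup>2 \<ge> 2 * (l1 - l2)\<^sup>2"
    by (simp add: p_def q_def power_divide)
  \<comment> \<open>Equal angles give \<open>u = 1\<close>, so both regimes reduce to finding
    \<open>y\<close> with \<open>(sin (2 * y))^2 = w0\<close>.\<close>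
  have opt: "h y y = K * (4 - 4 * F w0 1)" if "(sin (2 * y))\<^sup>2 = w0" for y
    unfolding h using that by (simp flip: mult_2)
  have min_iff: "is_minimizer2 h \<tau> \<theta> \<longleftrightarrow>
      [\<tau> = y] (rmod (pi / 2)) \<and> [\<theta> = y] (rmod (pi / 2)) \<or>
      [\<tau> = pi / 2 - y] (rmod (pi / 2)) \<and> [\<theta> = pi / 2 - y] (rmod (pi / 2))"
    if y: "(sin (2 * y))\<^sup>2 = w0" for y \<tau> \<theta>
  proof -
    \<comment> \<open>As \<open>h y y\<close> attains the global lower bound, minimality is a
      comparison with this single value.\<close>
    have "is_minimizer2 h \<tau> \<theta> \<longleftrightarrow> h \<tau> \<theta> \<le> h y y"
    proof
      assume le: "h \<tau> \<theta> \<le> h y y"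
      have "h y y \<le> h a b" for a b
        unfolding opt[OF y] unfolding h using K F_le by simp
      with le show "is_minimizer2 h \<tau> \<theta>"
        unfolding is_minimizer2_def by (meson order_trans)
    qed (simp add: is_minimizer2_def)
    also have "\<dots> \<longleftrightarrow> F (?w \<tau> \<theta>) (?u \<tau> \<theta>) = F w0 1"
      unfolding opt[OF y] unfolding h using K F_le[of \<tau> \<theta>] by auto
    finally show ?thesis
      unfolding F_eq unfolding y[symmetric] rcong_half_pi_pair_iff .
  qed
  show ?thesis
  proof (intro conjI impI)
    assume regime1: "2 * (l1 - l2)\<^sup>2 \<le> (l1 + l2)\<^sup>2"
    then have y: "(sin (2 * (pi / 4)))\<^sup>2 = w0" by (simp add: w0_def regime)
    \<comment> \<open>For \<open>y = pi / 4\<close> the classes of \<open>y\<close> and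
      \<open>pi / 2 - y\<close> coincide.\<close>
    show "\<forall>\<tau> \<theta>. is_minimizer2 h \<tau> \<theta> \<longleftrightarrow>
        [\<tau> = pi / 4] (rmod (pi / 2)) \<and> [\<theta> = pi / 4] (rmod (pi / 2))"
      unfolding min_iff[OF y] by simp
    show "h (pi / 4) (pi / 4) =
        1 / (4 * (l1 - l2)\<^sup>2) * (1 / (2 * real N)) * (4 - (l1 + l2)\<^sup>2)"
      using regime1 unfolding opt[OF y] K_def w0_def F_def regime by (simp add: p_def power_divide)
  next
    assume regime2: "(l1 + l2)\<^sup>2 < 2 * (l1 - l2)\<^sup>2"
    then have w0: "w0 = 1 / 2 + p\<^sup>2 / (4 * q\<^sup>2)" using regime by (simp add: w0_def)
    \<comment> \<open>The regime keeps the argument of \<open>arccos\<close> within its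
      domain.\<close>
    have "(l1 + l2)\<^sup>2 / (2 * (l1 - l2)\<^sup>2) \<le> 1" using regime2 by (simp add: divide_le_eq)
    moreover have "(l1 + l2)\<^sup>2 / (2 * (l1 - l2)\<^sup>2) \<ge> 0" by simp
    ultimately have "cos (arccos (- ((l1 + l2)\<^sup>2 / (2 * (l1 - l2)\<^sup>2)))) =
        - ((l1 + l2)\<^sup>2 / (2 * (l1 - l2)\<^sup>2))"
      by (intro cos_arccos) linarith+
    then have "cos (4 * x) = - ((l1 + l2)\<^sup>2 / (2 * (l1 - l2)\<^sup>2))"
      by (simp add: x_def)
    \<comment> \<open>By \<open>cos (4 * x) = 1 - 2 * (sin (2 * x))^2\<close>, the formula for
      \<open>x\<close> encodes exactly \<open>(sin (2 * x))^2 = w0\<close>.\<close>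
    then have "cos (2 * (2 * x)) = - (p\<^sup>2 / (2 * q\<^sup>2))"
      by (simp add: p_def q_def power_divide)
    then have y: "(sin (2 * x))\<^sup>2 = w0"
      unfolding w0 cos_double_sin by simp
    show "\<forall>\<tau> \<theta>. is_minimizer2 h \<tau> \<theta> \<longleftrightarrow>
        [\<tau> = x] (rmod (pi / 2)) \<and> [\<theta> = x] (rmod (pi / 2)) \<or>
        [\<tau> = pi / 2 - x] (rmod (pi / 2)) \<and> [\<theta> = pi / 2 - x] (rmod (pi / 2))"
      unfolding min_iff[OF y] by simp
    \<comment> \<open>The value at the vertex is \<open>2 * q^2 * w0^2\<close>, here
      expanded.\<close>
    have "F w0 1 = p\<^sup>2 / 2 + q\<^sup>2 / 2 + p ^ 4 / (8 * q\<^sup>2)"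
      unfolding F_def w0 using nz by (simp add: field_simps power2_eq_square power4_eq_xxxx)
    also have "4 - 4 * \<dots> = 4 - (l1\<^sup>2 + l2\<^sup>2) - 1 / 8 * ((l1 + l2) ^ 4 / (l1 - l2)\<^sup>2)"
    proof -
      have "p\<^sup>2 / 2 + q\<^sup>2 / 2 = (l1\<^sup>2 + l2\<^sup>2) / 4"
        by (simp add: p_def q_def power2_eq_square field_simps)
      moreover have "p ^ 4 / (8 * q\<^sup>2) = 1 / 32 * ((l1 + l2) ^ 4 / (l1 - l2)\<^sup>2)"
        by (simp add: p_def q_def power_divide)
      ultimately show ?thesis by simp
    qed
    finally have min_value: "h x x = 1 / (4 * (l1 - l2)\<^sup>2) * (1 / (2 * real N)) *
        (4 - (l1\<^sup>2 + l2\<^sup>2) - 1 / 8 * ((l1 + l2) ^ 4 / (l1 - l2)\<^sup>2))"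
      unfolding opt[OF y] K_def by simp
    \<comment> \<open>All minimizers share one value, so the value at \<open>(x, x)\<close> settles
      the claim.\<close>
    have "is_minimizer2 h x x" unfolding min_iff[OF y] by simp
    then show "\<forall>\<tau> \<theta>. is_minimizer2 h \<tau> \<theta> \<longrightarrow> h \<tau> \<theta> =
        1 / (4 * (l1 - l2)\<^sup>2) * (1 / (2 * real N)) *
        (4 - (l1\<^sup>2 + l2\<^sup>2) - 1 / 8 * ((l1 + l2) ^ 4 / (l1 - l2)\<^sup>2))"
      unfolding min_value[symmetric] is_minimizer2_def by (meson order_antisym)
  qed
qed

end
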